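(* Let $n$ be a positive integer. (1) If $x,y\in B^n$ are arbitrary, $t=|x-y|$ and $w=|x-y|\,e_1/2$, then $$j_{B^n}(x,y)\ge j_{B^n}(-w,w)=\log\frac{2+t}{2-t}=2\,\mathrm{artanh}(t/2)\ge t=|x-y|,$$ where the first inequality becomes an equality when $y=-x$. Moreover, the identity map $\mathrm{id}:(B^n,j_{B^n})\to(B^n,|\cdot|)$ has the sharp modulus of continuity $\omega(t)=2\tanh(t/2)$; that is, $|x-y|\le\omega(j_{B^n}(x,y))$ for all $x,y\in B^n$, and for every $t\ge0$ there exist $x,y\in B^n$ with $j_{B^n}(x,y)=t$ and $|x-y|=\omega(t)$. (2) Let $G\subsetneq\mathbb{R}^n$ be a domain with $\operatorname{diam}G<\infty$ and let $r=\sqrt{n/(2n+2)}\,\operatorname{diam}G$. Then for all distinct $x,y\in G$, with $t=|x-y|/r$, $$j_G(x,y)\ge\log\frac{2+t}{2-t}\ge t,$$ with equality in the first step when $G=B^n(z,r)$ and $z=(x+y)/2$. Moreover, the identity map $\mathrm{id}:(G,j_G)\to(G,|\cdot|)$ has the sharp modulus of continuity $\omega(t)=2r\tanh(t/2)$; that is, $|x-y|\le\omega(j_G(x,y))$ for all $x,y\in G$, with equality when $G=B^n(z,r)$ and $z=(x+y)/2$.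
   Context: $B^n(z,r)$ is the open Euclidean ball in $\mathbb{R}^n$ with center $z$ and radius $r$, $B^n=B^n(0,1)$, $e_1$ is the first standard unit vector, $|\cdot|$ is the Euclidean norm and $\operatorname{diam}$ the Euclidean diameter; $\mathrm{artanh}$ is the inverse hyperbolic tangent. For a domain (open connected nonempty set) $G\subsetneq\mathbb{R}^n$, $\delta_G(x)$ is the Euclidean distance from $x\in G$ to $\partial G$. The distance ratio metric of $G$ is $$j_G(x,y)=\log\left(1+\frac{|x-y|}{\min\{\delta_G(x),\delta_G(y)\}}\right),\qquad x,y\in G.$$ *)

theory Defs
  imports "HOL-Analysis.Analysis"
begin

definition bdry_dist :: "'a::metric_space set \<Rightarrow> 'a \<Rightarrow> real" where
  "bdry_dist G x = infdist x (frontier G)"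

text \<open>The distance ratio metric. It is meant for \<open>x, y \<in> G\<close> with \<open>G\<close> an open connected set,
  nonempty and different from the whole space; then \<open>frontier G\<close> is nonempty and the denominator
  is positive.\<close>

definition j_metric :: "'a::metric_space set \<Rightarrow> 'a \<Rightarrow> 'a \<Rightarrow> real" where
  "j_metric G x y = ln (1 + dist x y / min (bdry_dist G x) (bdry_dist G y))"

end

theory Submission
  imports Defs
begin

text \<open>If \<open>G\<close> lies in a ball of radius \<open>r\<close> with center \<open>z\<close>, then
  \<open>\<delta>\<^sub>G(x) \<le> r - |x - z|\<close>, so the smaller of the two boundary distances is at most their mean and hence
  at most \<open>r - |x - y| / 2\<close>; both bounds are attained when \<open>G\<close> is that ball and \<open>z\<close> is the midpoint.
  For a general bounded domain such a ball is supplied by Jung's theorem. By Helly's theorem this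
  reduces to at most \<open>n + 1\<close> points \<open>p\<^sub>i\<close>, where one maximizes the variance
  \<open>(\<Sum>i,j. \<lambda>\<^sub>i \<lambda>\<^sub>j |p\<^sub>i - p\<^sub>j|\<^sup>2) / 2\<close> over probability weights \<open>\<lambda>\<close>: the first-order conditions say that
  the barycenter has squared distance at most the variance to every \<open>p\<^sub>i\<close>, and the variance is at
  most \<open>(1 - \<Sum>i. \<lambda>\<^sub>i\<^sup>2) d\<^sup>2 / 2 \<le> n d\<^sup>2 / (2 n + 2)\<close>.\<close>

section \<open>Jung's theorem\<close>

text \<open>Expanding the squared distances gives two square terms, in each of which the free weight
  sums to 1, and a cross term that sums to the squared norm of the barycenter.\<close>

lemma weighted_variance_eq:
  fixes f :: "'i \<Rightarrow> 'a::real_inner"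
  assumes "sum u S = 1"
  shows "(\<Sum>i\<in>S. u i * (f i \<bullet> f i)) - (\<Sum>i\<in>S. u i *\<^sub>R f i) \<bullet> (\<Sum>i\<in>S. u i *\<^sub>R f i)
    = (\<Sum>i\<in>S. \<Sum>j\<in>S. u i * u j * (dist (f i) (f j))\<^sup>2) / 2"
proof -
  have 1: "u i * u j * (dist (f i) (f j))\<^sup>2
      = (u i * (f i \<bullet> f i)) * u j + u i * (u j * (f j \<bullet> f j)) - 2 * ((u i *\<^sub>R f i) \<bullet> (u j *\<^sub>R f j))"
    for i j
    by (simp add: dist_norm power2_norm_eq_inner inner_diff_left inner_diff_right inner_commute
        algebra_simps)
  have 2: "(\<Sum>i\<in>S. \<Sum>j\<in>S. (u i *\<^sub>R f i) \<bullet> (u j *\<^sub>R f j))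
      = (\<Sum>i\<in>S. u i *\<^sub>R f i) \<bullet> (\<Sum>i\<in>S. u i *\<^sub>R f i)"
    unfolding inner_sum_left inner_sum_right by (rule sum.swap)
  show ?thesis
    unfolding 1 sum.distrib sum_subtractf sum_distrib_left[symmetric] sum_distrib_right[symmetric] 2
    by (simp add: assms)
qed

text \<open>The diagonal of the double sum vanishes, so bounding only the other terms by
  \<open>d\<^sup>2\<close> leaves the factor 1 minus the sum of the squared weights. By
  Cauchy-Schwarz that sum is at least \<open>1 / card S\<close>.\<close>

lemma weighted_variance_le:
  fixes f :: "'i \<Rightarrow> 'a::real_inner"
  assumes "finite S" "S \<noteq> {}" "sum u S = 1" "\<And>i. i \<in> S \<Longrightarrow> 0 \<le> u i"
    and d: "\<And>i j. i \<in> S \<Longrightarrow> j \<in> S \<Longrightarrow> dist (f i) (f j) \<le> d"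
  shows "(\<Sum>i\<in>S. u i * (f i \<bullet> f i)) - (\<Sum>i\<in>S. u i *\<^sub>R f i) \<bullet> (\<Sum>i\<in>S. u i *\<^sub>R f i)
    \<le> d\<^sup>2 / 2 * (1 - 1 / card S)"
proof -
  have "(\<Sum>i\<in>S. \<Sum>j\<in>S. u i * u j * (dist (f i) (f j))\<^sup>2)
      \<le> (\<Sum>i\<in>S. \<Sum>j\<in>S. d\<^sup>2 * (u i * u j) - (if i = j then d\<^sup>2 * (u j)\<^sup>2 else 0))"
  proof (intro sum_mono)
    fix i j assume ij: "i \<in> S" "j \<in> S"
    have "(dist (f i) (f j))\<^sup>2 \<le> d\<^sup>2"
      by (intro power_mono d ij) simp
    then have "u i * u j * (dist (f i) (f j))\<^sup>2 \<le> u i * u j * d\<^sup>2"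
      using ij assms(4) by (intro mult_left_mono) auto
    then show "u i * u j * (dist (f i) (f j))\<^sup>2
        \<le> d\<^sup>2 * (u i * u j) - (if i = j then d\<^sup>2 * (u j)\<^sup>2 else 0)"
      by (auto simp: power2_eq_square algebra_simps)
  qed
  also have "\<dots> = d\<^sup>2 * (1 - (\<Sum>i\<in>S. (u i)\<^sup>2))"
    by (simp add: sum_subtractf assms(1,3) right_diff_distrib flip: sum_distrib_left)
  also have "\<dots> \<le> d\<^sup>2 * (1 - 1 / card S)"
  proof (intro mult_left_mono diff_left_mono)
    show "1 / card S \<le> (\<Sum>i\<in>S. (u i)\<^sup>2)"
      using sum_squared_le_sum_of_squares[of u S] assms(1,2,3)
      by (simp add: divide_le_eq card_gt_0_iff)
  qed simp
  finally show ?thesis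
    by (simp add: weighted_variance_eq[OF assms(3)])
qed

text \<open>The maximum is taken over the compact hull of the lifted points, so it exists by
  continuity. If some \<open>p\<close> were farther from the barycenter than the variance allows,
  moving a little weight to \<open>p\<close> would increase the variance.\<close>

lemma finite_subset_cball_variance:
  fixes S :: "'a::euclidean_space set"
  assumes "finite S" "S \<noteq> {}" "\<And>x y. x \<in> S \<Longrightarrow> y \<in> S \<Longrightarrow> dist x y \<le> d"
  shows "\<exists>z. \<forall>x\<in>S. (dist z x)\<^sup>2 \<le> d\<^sup>2 / 2 * (1 - 1 / card S)"
proof -
  \<comment> \<open>A point of \<open>K\<close> records both moments of a weight, so \<open>\<phi>\<close> is its variance.\<close>
  define g where "g = (\<lambda>p::'a. (p, p \<bullet> p))"
  define K where "K = convex hull (g ` S)"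
  define \<phi> where "\<phi> = (\<lambda>q::'a \<times> real. snd q - fst q \<bullet> fst q)"
  have inj: "inj_on g S"
    by (auto simp: g_def inj_on_def)
  have "compact K" "K \<noteq> {}"
    unfolding K_def using assms by (auto intro!: finite_imp_compact_convex_hull)
  moreover have "continuous_on K \<phi>"
    unfolding \<phi>_def by (intro continuous_intros)
  ultimately obtain q where q: "q \<in> K" "\<And>q'. q' \<in> K \<Longrightarrow> \<phi> q' \<le> \<phi> q"
    using continuous_attains_sup by metis
  obtain z a where za: "q = (z, a)"
    by (cases q)
  obtain v where v: "\<forall>y\<in>g ` S. 0 \<le> v y" "sum v (g ` S) = 1"
      "(\<Sum>y\<in>g ` S. v y *\<^sub>R y) = q"
    using q(1) assms(1) unfolding K_def convex_hull_finite[OF finite_imageI[OF assms(1)]] by blast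
  define u where "u = v \<circ> g"
  have u1: "sum u S = 1" and u0: "\<And>x. x \<in> S \<Longrightarrow> 0 \<le> u x"
    using v(1,2) by (auto simp: u_def sum.reindex[OF inj])
  have uq: "(\<Sum>x\<in>S. u x *\<^sub>R g x) = (z, a)"
    using v(3) by (simp add: u_def sum.reindex[OF inj] za)
  have z: "z = (\<Sum>x\<in>S. u x *\<^sub>R x)" and a: "a = (\<Sum>x\<in>S. u x * (x \<bullet> x))"
    using arg_cong[OF uq, of fst] arg_cong[OF uq, of snd]
    by (simp_all add: fst_sum snd_sum g_def)
  have var: "a - z \<bullet> z \<le> d\<^sup>2 / 2 * (1 - 1 / card S)"
    unfolding z a using weighted_variance_le[of S u "\<lambda>x. x" d] assms u1 u0 by auto
  have "(dist z p)\<^sup>2 \<le> a - z \<bullet> z" if p: "p \<in> S" for p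
  proof (rule ccontr)
    assume neg: "\<not> ?thesis"
    define c where "c = (dist z p)\<^sup>2 - (a - z \<bullet> z)"
    define D where "D = (dist z p)\<^sup>2"
    have c: "c > 0"
      using neg by (simp add: c_def)
    have "D \<ge> 0"
      by (simp add: D_def)
    \<comment> \<open>Moving the fraction \<epsilon> of the weight to \<open>p\<close> changes the
      variance by \<open>\<epsilon> * (c - \<epsilon> * D)\<close>, so
      \<open>\<epsilon> * D < c\<close> is wanted. The summand 1 keeps the denominator positive even
      for \<open>D = 0\<close>, and \<open>min 1\<close> keeps the new point in
      \<open>K\<close>.\<close>
    define \<epsilon> where "\<epsilon> = min 1 (c / (2 * (D + 1)))"
    have \<epsilon>: "0 < \<epsilon>" "\<epsilon> \<le> 1"
      using c \<open>D \<ge> 0\<close> by (auto simp: \<epsilon>_def)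
    have "\<epsilon> * D \<le> c / (2 * (D + 1)) * D"
      using \<open>D \<ge> 0\<close> by (intro mult_right_mono) (auto simp: \<epsilon>_def)
    also have "\<dots> < c"
      using c \<open>D \<ge> 0\<close> by (simp add: field_simps add_nonneg_pos)
    finally have less: "\<epsilon> * D < c" .
    have "g p \<in> K"
      using p by (auto simp: K_def intro: hull_inc)
    then have "(1 - \<epsilon>) *\<^sub>R q + \<epsilon> *\<^sub>R g p \<in> K"
      using q(1) \<epsilon> by (intro convexD) (auto simp: K_def)
    from q(2)[OF this]
    have "(1 - \<epsilon>) * a + \<epsilon> * (p \<bullet> p)
        - ((1 - \<epsilon>) *\<^sub>R z + \<epsilon> *\<^sub>R p) \<bullet> ((1 - \<epsilon>) *\<^sub>R z + \<epsilon> *\<^sub>R p) \<le> a - z \<bullet> z"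
      by (simp add: \<phi>_def za g_def)
    moreover have "(1 - \<epsilon>) * a + \<epsilon> * (p \<bullet> p)
        - ((1 - \<epsilon>) *\<^sub>R z + \<epsilon> *\<^sub>R p) \<bullet> ((1 - \<epsilon>) *\<^sub>R z + \<epsilon> *\<^sub>R p) - (a - z \<bullet> z)
        = \<epsilon> * (c - \<epsilon> * D)"
      unfolding c_def D_def
      by (simp add: dist_norm power2_norm_eq_inner inner_diff_left inner_diff_right
          inner_add_left inner_add_right inner_commute[of p z] algebra_simps)
    ultimately have "\<epsilon> * (c - \<epsilon> * D) \<le> 0"
      by linarith
    with \<epsilon>(1) less show False
      by (simp add: mult_le_0_iff)
  qed
  with var show ?thesis
    by (meson order_trans)
qed

text \<open>With at most n + 1 points the factor \<open>1 - 1 / card S\<close> is at most n / (n +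
  1); half of this is the constant under the root.\<close>

lemma Jung_card_le:
  fixes S :: "'a::euclidean_space set"
  assumes "finite S" "S \<noteq> {}" "card S \<le> DIM('a) + 1"
    and d: "\<And>x y. x \<in> S \<Longrightarrow> y \<in> S \<Longrightarrow> dist x y \<le> d"
  shows "\<exists>z. S \<subseteq> cball z (sqrt (DIM('a) / (2 * DIM('a) + 2)) * d)"
proof -
  have "0 \<le> d"
    using assms(2) d by (metis dist_self ex_in_conv)
  obtain z where z: "\<And>x. x \<in> S \<Longrightarrow> (dist z x)\<^sup>2 \<le> d\<^sup>2 / 2 * (1 - 1 / card S)"
    using finite_subset_cball_variance[OF assms(1,2) d] by blast
  have "1 / real (DIM('a) + 1) \<le> 1 / card S"
    using assms(1-3) by (intro divide_left_mono) (auto simp: card_gt_0_iff)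
  then have "d\<^sup>2 / 2 * (1 - 1 / card S) \<le> d\<^sup>2 / 2 * (1 - 1 / (DIM('a) + 1))"
    by (intro mult_left_mono) auto
  also have "\<dots> = DIM('a) / (2 * DIM('a) + 2) * d\<^sup>2"
    by (simp add: field_simps)
  finally have "dist z x \<le> sqrt (DIM('a) / (2 * DIM('a) + 2) * d\<^sup>2)" if "x \<in> S" for x
    using z[OF that] by (intro real_le_rsqrt) linarith
  then show ?thesis
    using \<open>0 \<le> d\<close> unfolding real_sqrt_mult by (intro exI[of _ z] subsetI) simp
qed

text \<open>A center is a common point of the closed balls of radius \<open>R\<close> about the
  points of \<open>S\<close>. Compactness reduces this to finite subfamilies, and Helly's theorem
  reduces those to n + 1 balls.\<close>

theorem Jung:
  fixes S :: "'a::euclidean_space set"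
  assumes "bounded S"
  shows "\<exists>z. S \<subseteq> cball z (sqrt (DIM('a) / (2 * DIM('a) + 2)) * diameter S)"
proof -
  define R where "R = sqrt (DIM('a) / (2 * DIM('a) + 2)) * diameter S"
  have d: "\<And>x y. x \<in> S \<Longrightarrow> y \<in> S \<Longrightarrow> dist x y \<le> diameter S"
    using assms diameter_bounded_bound by blast
  have small: "(\<Inter>x\<in>T. cball x R) \<noteq> {}" if "finite T" "T \<subseteq> S" "card T \<le> DIM('a) + 1" for T
  proof (cases "T = {}")
    case False
    with that d obtain z where "T \<subseteq> cball z R"
      using Jung_card_le[of T "diameter S"] unfolding R_def by blast
    then have "z \<in> (\<Inter>x\<in>T. cball x R)"
      by (auto simp: dist_commute)
    then show ?thesis by blast
  qed simp
  have "\<Inter> ((\<lambda>x. cball x R) ` S) \<noteq> {}"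
  proof (rule compact_fip_Heine_Borel)
    fix F assume "finite F" "F \<subseteq> (\<lambda>x. cball x R) ` S"
    \<comment> \<open>Helly's theorem counts balls whereas \<open>small\<close> counts centers;
      injectivity on \<open>T\<close> makes the two counts agree.\<close>
    then obtain T where T: "T \<subseteq> S" "finite T" "inj_on (\<lambda>x. cball x R) T" "F = (\<lambda>x. cball x R) ` T"
      by (metis finite_imageD subset_image_inj)
    show "\<Inter>F \<noteq> {}"
    proof (cases "card F \<le> DIM('a) + 1")
      case True
      then show ?thesis
        using small[of T] T by (simp add: card_image)
    next
      case False
      show ?thesis
      proof (rule Helly)
        show "DIM('a) + 1 \<le> card F" "\<forall>s\<in>F. convex s"
          using False T(4) by auto
        fix t assume t: "t \<subseteq> F" "card t = DIM('a) + 1"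
        then obtain U where U: "U \<subseteq> T" "inj_on (\<lambda>x. cball x R) U" "t = (\<lambda>x. cball x R) ` U"
          using T(4) by (metis subset_image_inj)
        moreover have "finite U" "card U = DIM('a) + 1"
          using t(2) U T(2) by (auto simp: card_image finite_subset)
        ultimately show "\<Inter>t \<noteq> {}"
          using small[of U] T(1) by auto
      qed
    qed
  qed auto
  then obtain z where "z \<in> (\<Inter>x\<in>S. cball x R)"
    by blast
  then show ?thesis
    unfolding R_def[symmetric] by (intro exI[of _ z]) (auto simp: dist_commute)
qed

section \<open>The distance ratio metric\<close>

lemma frontier_neq_empty:
  fixes G :: "'a::real_normed_vector set"
  assumes "G \<noteq> {}" "G \<noteq> UNIV"
  shows "frontier G \<noteq> {}"
  using connected_Int_frontier[of UNIV G] assms by auto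

lemma bdry_dist_pos:
  fixes G :: "'a::real_normed_vector set"
  assumes "open G" "G \<noteq> UNIV" "x \<in> G"
  shows "0 < bdry_dist G x"
  unfolding bdry_dist_def
proof (rule infdist_pos_not_in_closed)
  show "frontier G \<noteq> {}" "x \<notin> frontier G"
    using assms frontier_neq_empty[of G] by (auto simp: frontier_def interior_open)
qed simp

text \<open>A ball is connected, so one that meets both \<open>G\<close> and its complement contains
  a frontier point, which would be closer to \<open>x\<close> than the boundary distance.\<close>

lemma ball_bdry_dist_subset:
  fixes G :: "'a::real_normed_vector set"
  assumes "x \<in> G"
  shows "ball x (bdry_dist G x) \<subseteq> G"
proof (rule ccontr)
  assume "\<not> ?thesis"
  then have ne: "ball x (bdry_dist G x) - G \<noteq> {}"
    by blast
  \<comment> \<open>The radius may be 0, for instance by the default of \<open>infdist\<close> when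
    the frontier is empty; a ball that leaves \<open>G\<close> is nonempty and so contains its
    center.\<close>
  then have "x \<in> ball x (bdry_dist G x)"
    by (metis Diff_empty ball_eq_empty centre_in_ball empty_Diff linorder_not_less)
  with ne assms obtain y where "y \<in> ball x (bdry_dist G x)" "y \<in> frontier G"
    using connected_Int_frontier[of "ball x (bdry_dist G x)" G] by blast
  then show False
    using infdist_le[of y "frontier G" x] by (simp add: bdry_dist_def)
qed

text \<open>The ball about \<open>x\<close> inside \<open>G\<close> also lies in
  \<open>ball z r\<close>, and inclusion of Euclidean balls bounds its radius plus the distance of
  the centers by \<open>r\<close>.\<close>

lemma bdry_dist_le:
  fixes G :: "'a::euclidean_space set"
  assumes "open G" "x \<in> G" "G \<subseteq> ball z r"
  shows "bdry_dist G x \<le> r - dist x z"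
proof -
  have "G \<noteq> UNIV"
    using assms(3) bounded_ball not_bounded_UNIV bounded_subset by blast
  then have "0 < bdry_dist G x"
    using assms bdry_dist_pos by blast
  moreover have "ball x (bdry_dist G x) \<subseteq> ball z r"
    using ball_bdry_dist_subset[OF assms(2)] assms(3) by blast
  ultimately show ?thesis
    by (simp add: ball_subset_ball_iff)
qed

lemma bdry_dist_ball:
  fixes z :: "'a::euclidean_space"
  assumes "x \<in> ball z r"
  shows "bdry_dist (ball z r) x = r - dist x z"
proof (rule antisym)
  show "bdry_dist (ball z r) x \<le> r - dist x z"
    using assms by (intro bdry_dist_le) auto
  have "0 < r"
    using assms by (metis ball_eq_empty empty_iff linorder_not_less)
  then have fr: "frontier (ball z r) = sphere z r"
    by simp
  have "r - dist x z \<le> dist x y" if "y \<in> sphere z r" for y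
    using that dist_triangle[of z y x] by (simp add: dist_commute)
  then show "r - dist x z \<le> bdry_dist (ball z r) x"
    unfolding bdry_dist_def fr using \<open>0 < r\<close>
    by (auto simp: infdist_def intro!: cINF_greatest)
qed

section \<open>Logarithm, artanh and tanh\<close>

lemma ln_eq_artanh: "ln ((2 + t) / (2 - t)) = 2 * artanh (t / 2)" for t :: real
proof -
  \<comment> \<open>This holds even at \<open>t = 2\<close>, where division by zero gives 0 on both
    sides, so the lemma can be unfolded without side conditions.\<close>
  have "(2 + t) / (2 - t) = (2 * (1 + t / 2)) / (2 * (1 - t / 2))"
    by simp
  also have "\<dots> = (1 + t / 2) / (1 - t / 2)"
    by (rule mult_divide_mult_cancel_left) simp
  finally show ?thesis
    by (simp add: artanh_def)
qed

text \<open>The left side is the distance ratio of two points at distance \<open>s\<close> whose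
  smaller boundary distance is \<open>r - s / 2\<close>, the extremal case.\<close>

lemma ln_one_plus_eq_artanh:
  fixes r s :: real
  assumes "0 \<le> s" "s < 2 * r"
  shows "ln (1 + s / (r - s / 2)) = 2 * artanh (s / r / 2)"
proof -
  have "1 + s / (r - s / 2) = (2 + s / r) / (2 - s / r)"
    using assms by (simp add: field_simps)
  then show ?thesis
    by (simp add: ln_eq_artanh)
qed

lemma tanh_artanh_real:
  fixes u :: real
  assumes "\<bar>u\<bar> < 1"
  shows "tanh (artanh u) = u"
proof -
  have "exp (- 2 * artanh u) = (1 - u) / (1 + u)"
    using assms by (simp add: artanh_def exp_minus)
  then have "tanh (artanh u) = (1 - (1 - u) / (1 + u)) / (1 + (1 - u) / (1 + u))"
    by (simp add: tanh_real_altdef)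
  also have "\<dots> = u"
    using assms by (simp add: field_simps)
  finally show ?thesis .
qed

lemma artanh_ge_self:
  fixes u :: real
  assumes "0 \<le> u" "u < 1"
  shows "u \<le> artanh u"
proof -
  have "artanh 0 - 0 \<le> artanh u - u"
  proof (rule DERIV_nonneg_imp_nondecreasing[OF assms(1)])
    fix x assume x: "0 \<le> x" "x \<le> u"
    with assms have "\<bar>x\<bar> < 1" "x\<^sup>2 < 1"
      by (auto simp: abs_square_less_1)
    then have "((\<lambda>x. artanh x - x) has_real_derivative 1 / (1 - x\<^sup>2) - 1) (at x)" "0 \<le> 1 / (1 - x\<^sup>2) - 1"
      by (auto intro!: derivative_eq_intros)
    then show "\<exists>y. ((\<lambda>x. artanh x - x) has_real_derivative y) (at x) \<and> 0 \<le> y"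
      by blast
  qed
  then show ?thesis by simp
qed

section \<open>Comparison with an enclosing ball\<close>

lemma norm_diff_less_if_in_ball:
  fixes z :: "'a::real_normed_vector"
  assumes "x \<in> ball z r" "y \<in> ball z r"
  shows "norm (x - y) < 2 * r"
  using assms dist_triangle_less_add[of x z r y r] by (simp add: dist_commute dist_norm[symmetric])

text \<open>This serves both halves of the theorem: the unit ball encloses itself, and a general
  bounded domain is enclosed by the ball from Jung's theorem.\<close>

lemma j_metric_ge:
  fixes G :: "'a::euclidean_space set"
  assumes G: "open G" "G \<subseteq> ball z r" and xy: "x \<in> G" "y \<in> G"
  shows "2 * artanh (norm (x - y) / r / 2) \<le> j_metric G x y"
proof -
  define s where "s = norm (x - y)"
  have s: "0 \<le> s" "s < 2 * r"
    using norm_diff_less_if_in_ball[OF subsetD[OF G(2) xy(1)] subsetD[OF G(2) xy(2)]]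
    by (auto simp: s_def)
  have "G \<noteq> UNIV"
    using G(2) bounded_ball not_bounded_UNIV bounded_subset by blast
  then have pos: "0 < min (bdry_dist G x) (bdry_dist G y)"
    using assms bdry_dist_pos by auto
  have "s \<le> dist x z + dist y z"
    unfolding s_def dist_norm[symmetric] by (rule dist_triangle2)
  then have "min (bdry_dist G x) (bdry_dist G y) \<le> r - s / 2"
    using bdry_dist_le[OF G(1) xy(1) G(2)] bdry_dist_le[OF G(1) xy(2) G(2)] by linarith
  then have "s / (r - s / 2) \<le> s / min (bdry_dist G x) (bdry_dist G y)"
    using s pos by (intro divide_left_mono) auto
  then have "ln (1 + s / (r - s / 2)) \<le> ln (1 + s / min (bdry_dist G x) (bdry_dist G y))"
    using s by (intro ln_mono) (auto intro!: add_pos_nonneg)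
  then show ?thesis
    using ln_one_plus_eq_artanh[OF s] by (simp add: j_metric_def s_def dist_norm)
qed

lemma norm_diff_le_tanh_j_metric:
  fixes G :: "'a::euclidean_space set"
  assumes "open G" "G \<subseteq> ball z r" "x \<in> G" "y \<in> G"
  shows "norm (x - y) \<le> 2 * r * tanh (j_metric G x y / 2)"
proof -
  have "norm (x - y) < 2 * r"
    by (intro norm_diff_less_if_in_ball[of _ z] subsetD[OF assms(2)] assms)
  moreover from this have r: "0 < r"
    using norm_ge_zero[of "x - y"] by linarith
  ultimately have "norm (x - y) / r / 2 = tanh (artanh (norm (x - y) / r / 2))"
    by (subst tanh_artanh_real) (auto simp: field_simps)
  also have "\<dots> \<le> tanh (j_metric G x y / 2)"
    using j_metric_ge[OF assms] by simp
  finally show ?thesis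
    using r by (simp add: field_simps)
qed

text \<open>Both points lie at distance \<open>s / 2\<close> from the center, so both boundary
  distances equal \<open>r - s / 2\<close> and the estimate of \<open>j_metric_ge\<close> becomes
  exact.\<close>

lemma j_metric_ball_symmetric:
  fixes z :: "'a::euclidean_space"
  assumes "x \<in> ball z r" "y \<in> ball z r" "z = (1 / 2) *\<^sub>R (x + y)"
  shows "j_metric (ball z r) x y = 2 * artanh (norm (x - y) / r / 2)"
    and "norm (x - y) = 2 * r * tanh (j_metric (ball z r) x y / 2)"
proof -
  define s where "s = norm (x - y)"
  have s: "0 \<le> s" "s < 2 * r"
    using norm_diff_less_if_in_ball assms by (auto simp: s_def)
  then have r: "0 < r" by linarith
  have "x - z = (1 / 2) *\<^sub>R (x - y)" "y - z = (1 / 2) *\<^sub>R (y - x)"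
    unfolding assms(3)
    by (simp_all add: algebra_simps flip: scaleR_2)
  then have d: "dist x z = s / 2" "dist y z = s / 2"
    by (simp_all add: dist_norm s_def norm_minus_commute)
  then show j: "j_metric (ball z r) x y = 2 * artanh (norm (x - y) / r / 2)"
    using ln_one_plus_eq_artanh[OF s]
    unfolding j_metric_def bdry_dist_ball[OF assms(1)] bdry_dist_ball[OF assms(2)] d
    by (simp add: s_def dist_norm)
  have "tanh (artanh (s / r / 2)) = s / r / 2"
    using s r by (intro tanh_artanh_real) (auto simp: field_simps)
  then show "norm (x - y) = 2 * r * tanh (j_metric (ball z r) x y / 2)"
    using r unfolding j by (simp add: s_def)
qed

text \<open>An open set inside a closed ball lies in its interior. The open ball is what the
  comparison lemmas require.\<close>

lemma open_subset_ball_Jung: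
  fixes G :: "'a::euclidean_space set"
  assumes "open G" "bounded G"
  shows "\<exists>z. G \<subseteq> ball z (sqrt (DIM('a) / (2 * DIM('a) + 2)) * diameter G)"
  using Jung[OF assms(2)] interior_maximal[OF _ assms(1)] by (metis interior_cball)

text \<open>The last conjunct states the equality case for balls of any radius \<open>r > 0\<close>:
  such a ball has diameter 2r, so it satisfies
  \<open>r = sqrt (n / (2 * n + 2)) * diameter G\<close> only for n = 1. The index \<open>k\<close>
  makes \<open>e\<^sub>1\<close> an arbitrary standard unit vector.\<close>

theorem theorem3p4:
  fixes k :: "'n::finite"
  defines "B \<equiv> ball (0 :: real ^ 'n) 1"
    and "e\<^sub>1 \<equiv> (axis k 1 :: real ^ 'n)"
    and "n \<equiv> real CARD('n)"
  shows "
    (\<forall>x\<in>B. \<forall>y\<in>B.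
       (let t = norm (x - y); w = (norm (x - y) / 2) *\<^sub>R e\<^sub>1
        in j_metric B x y \<ge> j_metric B (- w) w
         \<and> j_metric B (- w) w = ln ((2 + t) / (2 - t))
         \<and> ln ((2 + t) / (2 - t)) = 2 * artanh (t / 2)
         \<and> 2 * artanh (t / 2) \<ge> t
         \<and> (y = - x \<longrightarrow> j_metric B x y = j_metric B (- w) w)))
  \<and> (\<forall>x\<in>B. \<forall>y\<in>B. norm (x - y) \<le> 2 * tanh (j_metric B x y / 2))
  \<and> (\<forall>t\<ge>0. \<exists>x\<in>B. \<exists>y\<in>B. j_metric B x y = t \<and> norm (x - y) = 2 * tanh (t / 2))
  \<and> (\<forall>G :: (real ^ 'n) set.
       open G \<and> connected G \<and> G \<noteq> {} \<and> G \<noteq> UNIV \<and> bounded G \<longrightarrow>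
       (let r = sqrt (n / (2 * n + 2)) * diameter G
        in (\<forall>x\<in>G. \<forall>y\<in>G. x \<noteq> y \<longrightarrow>
             (let t = norm (x - y) / r
              in j_metric G x y \<ge> ln ((2 + t) / (2 - t))
               \<and> ln ((2 + t) / (2 - t)) \<ge> t
               \<and> (\<forall>z. z = (1 / 2) *\<^sub>R (x + y) \<and> G = ball z r \<longrightarrow>
                     j_metric G x y = ln ((2 + t) / (2 - t)))))
         \<and> (\<forall>x\<in>G. \<forall>y\<in>G.
              norm (x - y) \<le> 2 * r * tanh (j_metric G x y / 2)
            \<and> (\<forall>z. z = (1 / 2) *\<^sub>R (x + y) \<and> G = ball z r \<longrightarrow>
                  norm (x - y) = 2 * r * tanh (j_metric G x y / 2)))))
  \<and> (\<forall>(z :: real ^ 'n) r. r > 0 \<longrightarrow>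
       (\<forall>x\<in>ball z r. \<forall>y\<in>ball z r. z = (1 / 2) *\<^sub>R (x + y) \<longrightarrow>
          (x \<noteq> y \<longrightarrow>
             (let t = norm (x - y) / r in j_metric (ball z r) x y = ln ((2 + t) / (2 - t))))
        \<and> norm (x - y) = 2 * r * tanh (j_metric (ball z r) x y / 2)))"
proof -
  have ball_symm: "j_metric B x y = 2 * artanh (norm (x - y) / 2)"
      "norm (x - y) = 2 * tanh (j_metric B x y / 2)" if "x \<in> B" "y = - x" for x y
    using j_metric_ball_symmetric[of x 0 1 y] that by (simp_all add: B_def)
  have ge: "t \<le> 2 * artanh (t / 2)" if "0 \<le> t" "t < 2" for t :: real
    using artanh_ge_self[of "t / 2"] that by simp
  have lt2: "norm (x - y) < 2" if "x \<in> B" "y \<in> B" for x y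
    using norm_diff_less_if_in_ball[of x 0 1 y] that by (simp add: B_def)
  have sharp: "\<exists>x\<in>B. \<exists>y\<in>B. j_metric B x y = t \<and> norm (x - y) = 2 * tanh (t / 2)"
    if "0 \<le> t" for t
  proof (intro bexI conjI)
    \<comment> \<open>The antipodal pair is scaled to have distance \<open>2 * tanh (t / 2)\<close>;
      \<open>ball_symm\<close> then gives \<open>2 * artanh (tanh (t / 2))\<close>, which is
      \<open>t\<close>.\<close>
    let ?x = "tanh (t / 2) *\<^sub>R e\<^sub>1"
    have x: "?x \<in> B" "norm (?x - - ?x) = 2 * tanh (t / 2)"
      using that tanh_real_lt_1[of "t / 2"]
      by (auto simp: B_def e\<^sub>1_def simp flip: scaleR_2)
    then show "?x \<in> B" "- ?x \<in> B" "norm (?x - - ?x) = 2 * tanh (t / 2)"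
      by (auto simp: B_def)
    show "j_metric B ?x (- ?x) = t"
      using ball_symm(1)[OF x(1) refl] unfolding x(2) by (simp add: artanh_tanh_real)
  qed
  show ?thesis
  proof (intro conjI allI ballI impI)
    fix x y assume xy: "x \<in> B" "y \<in> B"
    define w where "w = (norm (x - y) / 2) *\<^sub>R e\<^sub>1"
    \<comment> \<open>The pair \<open>- w\<close>, \<open>w\<close> is antipodal and as far apart as
      \<open>x\<close>, \<open>y\<close>, so \<open>ball_symm\<close> evaluates its distance ratio
      to the lower bound for \<open>x\<close>, \<open>y\<close>.\<close>
    have "- w - w = - norm (x - y) *\<^sub>R e\<^sub>1"
      by (simp add: w_def flip: scaleR_diff_left scaleR_minus_left)
    then have w: "- w \<in> B" "norm (- w - w) = norm (x - y)"
      using lt2[OF xy] by (auto simp: w_def B_def e\<^sub>1_def)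
    have jw: "j_metric B (- w) w = 2 * artanh (norm (x - y) / 2)"
      using ball_symm(1)[OF w(1), of w] unfolding w(2) by simp
    show "let t = norm (x - y); w = (norm (x - y) / 2) *\<^sub>R e\<^sub>1
        in j_metric B x y \<ge> j_metric B (- w) w
         \<and> j_metric B (- w) w = ln ((2 + t) / (2 - t))
         \<and> ln ((2 + t) / (2 - t)) = 2 * artanh (t / 2)
         \<and> 2 * artanh (t / 2) \<ge> t
         \<and> (y = - x \<longrightarrow> j_metric B x y = j_metric B (- w) w)"
      using j_metric_ge[of B 0 1 x y] ball_symm(1)[OF xy(1), of y] xy lt2[OF xy]
        ge[of "norm (x - y)"]
      unfolding Let_def ln_eq_artanh w_def[symmetric] jw by (auto simp: B_def)
    show "norm (x - y) \<le> 2 * tanh (j_metric B x y / 2)"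
      using norm_diff_le_tanh_j_metric[of B 0 1 x y] xy by (simp add: B_def)
  next
    fix t :: real assume "0 \<le> t"
    then show "\<exists>x\<in>B. \<exists>y\<in>B. j_metric B x y = t \<and> norm (x - y) = 2 * tanh (t / 2)"
      by (rule sharp)
  next
    fix G :: "(real ^ 'n) set"
    assume G: "open G \<and> connected G \<and> G \<noteq> {} \<and> G \<noteq> UNIV \<and> bounded G"
    define r where "r = sqrt (n / (2 * n + 2)) * diameter G"
    have "\<exists>c. G \<subseteq> ball c r"
      using open_subset_ball_Jung[of G] G by (simp add: r_def n_def add.commute)
    then obtain c where c: "G \<subseteq> ball c r" ..
    \<comment> \<open>Positivity is read off from the nonempty \<open>G\<close> inside
      \<open>ball c r\<close>, with no separate argument about the diameter.\<close>
    have r: "0 < r"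
      using c G by (metis ball_eq_empty linorder_not_less subset_empty)
    have t: "norm (x - y) / r \<le> 2 * artanh (norm (x - y) / r / 2)" if "x \<in> G" "y \<in> G" for x y
      using norm_diff_less_if_in_ball[OF subsetD[OF c that(1)] subsetD[OF c that(2)]] r
      by (intro ge) (auto simp: field_simps)
    show "let r = sqrt (n / (2 * n + 2)) * diameter G
        in (\<forall>x\<in>G. \<forall>y\<in>G. x \<noteq> y \<longrightarrow>
             (let t = norm (x - y) / r
              in j_metric G x y \<ge> ln ((2 + t) / (2 - t))
               \<and> ln ((2 + t) / (2 - t)) \<ge> t
               \<and> (\<forall>z. z = (1 / 2) *\<^sub>R (x + y) \<and> G = ball z r \<longrightarrow>
                     j_metric G x y = ln ((2 + t) / (2 - t)))))
         \<and> (\<forall>x\<in>G. \<forall>y\<in>G.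
              norm (x - y) \<le> 2 * r * tanh (j_metric G x y / 2)
            \<and> (\<forall>z. z = (1 / 2) *\<^sub>R (x + y) \<and> G = ball z r \<longrightarrow>
                  norm (x - y) = 2 * r * tanh (j_metric G x y / 2)))"
      unfolding Let_def ln_eq_artanh r_def[symmetric]
    proof (intro conjI ballI impI allI; (elim conjE)?)
      fix x y assume xy: "x \<in> G" "y \<in> G"
      show "2 * artanh (norm (x - y) / r / 2) \<le> j_metric G x y"
        using j_metric_ge[OF _ c xy] G by blast
      show "norm (x - y) / r \<le> 2 * artanh (norm (x - y) / r / 2)"
        by (rule t[OF xy])
      show "norm (x - y) \<le> 2 * r * tanh (j_metric G x y / 2)"
        using norm_diff_le_tanh_j_metric[OF _ c xy] G by blast
      fix z assume z: "z = (1 / 2) *\<^sub>R (x + y)" "G = ball z r"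
      note j = j_metric_ball_symmetric[OF xy[unfolded z(2)] z(1), folded z(2)]
      show "j_metric G x y = 2 * artanh (norm (x - y) / r / 2)"
        by (rule j(1))
      show "norm (x - y) = 2 * r * tanh (j_metric G x y / 2)"
        by (rule j(2))
    qed
  next
    fix z :: "real ^ 'n" and r :: real and x y
    assume "x \<in> ball z r" "y \<in> ball z r" "z = (1 / 2) *\<^sub>R (x + y)"
    note j = j_metric_ball_symmetric[OF this]
    show "let t = norm (x - y) / r in j_metric (ball z r) x y = ln ((2 + t) / (2 - t))"
      unfolding Let_def ln_eq_artanh by (rule j(1))
    show "norm (x - y) = 2 * r * tanh (j_metric (ball z r) x y / 2)"
      by (rule j(2))
  qed
qed

end
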